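(* Let $p \ge 2$ be an integer and let $(y_i)_{i\ge 1}$ be a sequence of points of $\mathbb{S}^{p-1}$. Set $\mathcal{Y}_n = \{y_1,\dots,y_n\}$ and $\mathcal{Y}_\infty = \{y_i : i \ge 1\}$. If $p=2$, assume that the closure $\operatorname{cl}(\mathcal{Y}_\infty)$ contains an open hemisphere, while if $p\ge 3$, assume that $\operatorname{cl}(\mathcal{Y}_\infty)$ has non-empty interior relative to $\mathbb{S}^{p-1}$. For each $n$, let $(x_n, x_n') \in \mathbb{S}^{p-1}\times\mathbb{S}^{p-1}$ be a pair of points that are weakly equivalent with respect to $\mathcal{Y}_n$, that is, $$\langle x_n, y\rangle < \langle x_n, y'\rangle \implies \langle x_n', y\rangle \le \langle x_n', y'\rangle, \qquad \text{for all } y,y' \in \mathcal{Y}_n.$$ Then any accumulation point of the sequence $((x_n,x_n'))_{n\ge 1}$ in $\mathbb{S}^{p-1}\times \mathbb{S}^{p-1}$ must be of the form $(x,x)$. In particular, if both $(x_n)$ and $(x_n')$ converge, their limits must coincide.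
   Context: $\mathbb{S}^{p-1} = \{x\in\mathbb{R}^p : \|x\|=1\}$, with the topology induced from $\mathbb{R}^p$; $\langle\cdot,\cdot\rangle$ is the Euclidean inner product. An open hemisphere is a set of the form $\{x\in \mathbb{S}^{p-1} : \langle x,u\rangle > 0\}$ for some $u \in \mathbb{S}^{p-1}$. An accumulation point of a sequence is the limit of some subsequence. *)

theory Defs
  imports "HOL-Analysis.Analysis"
begin

definition open_hemisphere :: "'a::real_inner set \<Rightarrow> bool" where
  "open_hemisphere H \<longleftrightarrow> (\<exists>u \<in> sphere 0 1. H = {x \<in> sphere 0 1. inner x u > 0})"

definition weakly_equivalent :: "'a::real_inner set \<Rightarrow> 'a \<Rightarrow> 'a \<Rightarrow> bool" where
  "weakly_equivalent Y x x' \<longleftrightarrow>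
     (\<forall>y\<in>Y. \<forall>y'\<in>Y. inner x y < inner x y' \<longrightarrow> inner x' y \<le> inner x' y')"

(* Sequences are indexed by n \<ge> 1, so the value at index 0 is never used in a subsequence. *)
definition seq_accumulation_point :: "(nat \<Rightarrow> 'a::topological_space) \<Rightarrow> 'a \<Rightarrow> bool" where
  "seq_accumulation_point s a \<longleftrightarrow>
     (\<exists>r. strict_mono r \<and> (\<forall>k. r k \<ge> 1) \<and> (s \<circ> r) \<longlonglongrightarrow> a)"

end

theory Submission
  imports Defs
begin

text \<open>A limit pair (a, b) is weakly equivalent with respect to the closure of the y_i. Moving
  inside a relatively open subset of that closure from a point y along a great circle with tangent t,
  the functionals of a and b may not change with opposite strict signs, so it suffices to find,
  when a and b differ, such a y and a tangent t at y with <a,t> < 0 < <b,t>.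
  In dimension at least 3, y can be chosen outside the span of a and b, and t is the difference of
  the normalised projections of b and a to the tangent space at y.
  In dimension 2, t = b - a up to a small perturbation; a point of the hemisphere is orthogonal to it
  as soon as t is not parallel to the pole.\<close>

lemma weakly_equivalent_tangent:
  fixes a b y t :: "'a::real_inner"
  assumes weq: "weakly_equivalent K a b" and U: "openin (top_of_set (sphere 0 1)) U" "U \<subseteq> K"
    and y: "y \<in> U" and orth: "inner y t = 0" and neg: "inner a t < 0"
  shows "inner b t \<le> 0"
proof (rule ccontr)
  assume "\<not> inner b t \<le> 0"
  then have pos: "inner b t > 0" by simp
  obtain V where V: "open V" "U = sphere 0 1 \<inter> V" using U(1) by (auto simp: openin_open)
  have "t \<noteq> 0" using neg by auto
  define \<tau> where "\<tau> = t /\<^sub>R norm t"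
  \<comment> \<open>Great circle through y: it stays on the sphere, is at y for s = 0 and has
    velocity \<tau> there, so \<open>inner c (\<gamma> s)\<close> has derivative
    \<open>inner c \<tau>\<close> at 0.\<close>
  define \<gamma> where "\<gamma> s = cos s *\<^sub>R y + sin s *\<^sub>R \<tau>" for s :: real
  have yy: "inner y y = 1" using y V by (simp add: norm_eq_1)
  have \<tau>\<tau>: "inner \<tau> \<tau> = 1" and y\<tau>: "inner y \<tau> = 0"
    using \<open>t \<noteq> 0\<close> orth
    by (auto simp: \<tau>_def dot_square_norm power2_eq_square)
  have on_sphere: "norm (\<gamma> s) = 1" for s
    unfolding norm_eq_1 \<gamma>_def
    using yy \<tau>\<tau> y\<tau> sin_cos_squared_add2[of s]
    by (simp add: inner_add_left inner_add_right inner_commute[of \<tau> y] power2_eq_square algebra_simps)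
  have "isCont \<gamma> 0" unfolding \<gamma>_def by (intro continuous_intros)
  then have "(\<gamma> \<longlongrightarrow> y) (at_right 0)"
    by (auto simp: isCont_def \<gamma>_def filterlim_at_split)
  then have "eventually (\<lambda>s. \<gamma> s \<in> V) (at_right 0)"
    using V y by (auto dest: topological_tendstoD)
  then have ev_in: "eventually (\<lambda>s. \<gamma> s \<in> K) (at_right 0)"
    by eventually_elim (use U(2) V on_sphere in auto)
  have deriv: "((\<lambda>s. inner c (\<gamma> s)) has_real_derivative inner c \<tau>) (at 0)" for c
    unfolding \<gamma>_def by (auto simp: inner_add_right intro!: derivative_eq_intros)
  have "inner a \<tau> < 0" "inner b \<tau> > 0"
    using neg pos \<open>t \<noteq> 0\<close> by (auto simp: \<tau>_def divide_simps)
  then obtain d e where "d > 0" "\<And>s. 0 < s \<Longrightarrow> s < d \<Longrightarrow> inner a (\<gamma> s) < inner a y"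
    and "e > 0" "\<And>s. 0 < s \<Longrightarrow> s < e \<Longrightarrow> inner b (\<gamma> s) > inner b y"
    using DERIV_neg_dec_right[OF deriv[of a]] DERIV_pos_inc_right[OF deriv[of b]]
    by (auto simp: \<gamma>_def)
  \<comment> \<open>For small s > 0 the points \<gamma> s and y of K are ordered strictly and
    oppositely by a and b, which weak equivalence forbids.\<close>
  then have "eventually (\<lambda>s. inner a (\<gamma> s) < inner a y \<and> inner b (\<gamma> s) > inner b y) (at_right 0)"
    unfolding eventually_at_right_field by (intro exI[of _ "min d e"]) auto
  with ev_in have "eventually (\<lambda>s::real. False) (at_right 0)"
    by eventually_elim (use weq U(2) y in \<open>force simp: weakly_equivalent_def\<close>)
  then show False by simp
qed

lemma unit_vectors_inner_less:
  fixes a b :: "'a::real_inner"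
  assumes "norm a = 1" "norm b = 1" "a \<noteq> b"
  shows "inner a b < 1"
proof -
  have "inner (b - a) (b - a) > 0" using assms by simp
  then show ?thesis using assms
    by (simp add: inner_diff_left inner_diff_right norm_eq_1 inner_commute)
qed

lemma exists_nonzero_orthogonal:
  fixes B :: "'a::euclidean_space set"
  assumes "finite B" "card B < DIM('a)"
  obtains v where "v \<noteq> 0" "\<And>b. b \<in> B \<Longrightarrow> inner v b = 0"
proof -
  have "dim B < DIM('a)" using dim_le_card'[OF assms(1)] assms(2) by simp
  then obtain v where "v \<noteq> 0" "\<And>b. b \<in> span B \<Longrightarrow> orthogonal v b"
    using orthogonal_to_subspace_exists[of B] by blast
  then show ?thesis using that by (auto simp: orthogonal_def span_base)
qed

text \<open>If U lay in the hyperplane orthogonal to v, then -v and v would both vanish on U and be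
  vacuously weakly equivalent there; the tangent lemma with t = v would give
  \<open>inner v v \<le> 0\<close>.\<close>

lemma relatively_open_point_off_hyperplane:
  fixes v :: "'a::real_inner"
  assumes U: "openin (top_of_set (sphere 0 1)) U" "U \<noteq> {}" and "v \<noteq> 0"
  obtains y where "y \<in> U" "inner y v \<noteq> 0"
proof -
  obtain c where "c \<in> U" using U by blast
  have "inner v v \<le> 0" if *: "\<And>y. y \<in> U \<Longrightarrow> inner y v = 0"
  proof (rule weakly_equivalent_tangent[OF _ U(1) order_refl \<open>c \<in> U\<close>])
    show "weakly_equivalent U (- v) v"
      using * by (simp add: weakly_equivalent_def inner_commute)
    show "inner c v = 0" using * \<open>c \<in> U\<close> .
    show "inner (- v) v < 0" using \<open>v \<noteq> 0\<close> by simp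
  qed
  then show ?thesis using that \<open>v \<noteq> 0\<close> by (metis inner_gt_zero_iff not_le)
qed

text \<open>From dimension 3 on, a and b lie in a common hyperplane through 0, and U has a point y
  outside it. Seen from such a y, distinct unit vectors a and b have different tangential
  directions.\<close>

lemma weakly_equivalent_open_eq:
  fixes a b :: "'a::euclidean_space"
  assumes dim: "DIM('a) \<ge> 3" and weq: "weakly_equivalent K a b"
    and U: "openin (top_of_set (sphere 0 1)) U" "U \<subseteq> K" "U \<noteq> {}"
    and unit: "norm a = 1" "norm b = 1"
  shows "a = b"
proof (rule ccontr)
  assume "a \<noteq> b"
  have "card {a, b} < DIM('a)" using dim by (simp add: card_insert_if)
  then obtain v where v: "v \<noteq> 0" "inner a v = 0" "inner b v = 0"
    by (metis exists_nonzero_orthogonal finite.emptyI finite.insertI inner_commute insertCI)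
  obtain y where y: "y \<in> U" "inner y v \<noteq> 0"
    using relatively_open_point_off_hyperplane[OF U(1,3) v(1)] .
  have yy: "inner y y = 1" using y openin_imp_subset[OF U(1)] by (auto simp: norm_eq_1)
  \<comment> \<open>Projection to the tangent space at y; it does not change the inner product with
    a tangent vector.\<close>
  define P where "P c = c - inner c y *\<^sub>R y" for c
  have Py: "inner y (P c) = 0" for c
    using yy by (simp add: P_def inner_diff_right inner_commute)
  have inner_P: "inner c t = inner (P c) t" if "inner y t = 0" for c t
    using that by (simp add: P_def inner_diff_left)
  \<comment> \<open>The line through y meets the hyperplane orthogonal to v, which contains a and b,
    only in 0.\<close>
  have parallel: "c = 0" if "c = k *\<^sub>R y" "inner c v = 0" for c k
    using that y(2) by auto
  have Pa: "P a \<noteq> 0" and Pb: "P b \<noteq> 0"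
    using parallel[of a "inner a y"] parallel[of b "inner b y"] v unit by (auto simp: P_def)
  \<comment> \<open>Equal directions would make a - r b, for some r \<ge> 0, a multiple of y. It is
    then 0, and comparing norms gives r = 1.\<close>
  have ne: "sgn (P a) \<noteq> sgn (P b)"
  proof
    assume eq: "sgn (P a) = sgn (P b)"
    define r where "r = norm (P a) / norm (P b)"
    have "P a = norm (P a) *\<^sub>R sgn (P a)" using Pa by (simp add: sgn_div_norm)
    also have "\<dots> = r *\<^sub>R P b" unfolding eq by (simp add: r_def sgn_div_norm divide_inverse)
    finally have "a - r *\<^sub>R b = (inner a y - r * inner b y) *\<^sub>R y"
      by (simp add: P_def algebra_simps)
    then have "a - r *\<^sub>R b = 0"
      by (rule parallel) (simp add: v inner_diff_left)
    moreover have "r \<ge> 0" by (simp add: r_def)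
    ultimately have "r = 1" using unit by (metis abs_of_nonneg eq_iff_diff_eq_0 mult.right_neutral norm_scaleR)
    with \<open>a - r *\<^sub>R b = 0\<close> \<open>a \<noteq> b\<close> show False by simp
  qed
  \<comment> \<open>For distinct unit vectors p and q, the difference q - p has product <p,q> - 1 <
    0 with p and 1 - <p,q> > 0 with q. Scaling by the positive norms of \<open>P a\<close> and
    \<open>P b\<close> carries these signs over to a and b.\<close>
  define t where "t = sgn (P b) - sgn (P a)"
  have yt: "inner y t = 0" by (simp add: t_def inner_diff_right sgn_div_norm Py)
  have less: "inner (sgn (P a)) (sgn (P b)) < 1"
    by (rule unit_vectors_inner_less) (use Pa Pb ne in \<open>auto simp: norm_sgn\<close>)
  have one: "inner (sgn (P c)) (sgn (P c)) = 1" if "P c \<noteq> 0" for c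
    using that by (simp add: norm_sgn flip: norm_eq_1)
  have scale: "inner c t = norm (P c) * inner (sgn (P c)) t" if "P c \<noteq> 0" for c
    using that inner_P[OF yt, of c] by (simp add: sgn_div_norm)
  have "inner (sgn (P a)) t < 0" "inner (sgn (P b)) t > 0"
    using less one[OF Pa] one[OF Pb] by (simp_all add: t_def inner_diff_right inner_commute)
  then have "inner a t < 0" "inner b t > 0"
    using Pa Pb by (simp_all add: scale mult_less_0_iff)
  moreover from this have "inner b t \<le> 0"
    by (intro weakly_equivalent_tangent[OF weq U(1,2) y(1) yt])
  ultimately show False by simp
qed

text \<open>The direction b - a has strict opposite signs against a and b, and its orthogonal
  complement meets H unless b - a is a multiple of the pole u. A small push along some w orthogonal
  to u avoids this exception and keeps both signs.\<close>

lemma weakly_equivalent_hemisphere_eq: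
  fixes a b :: "'a::euclidean_space"
  assumes dim: "DIM('a) \<ge> 2" and weq: "weakly_equivalent K a b"
    and H: "open_hemisphere H" "H \<subseteq> K"
    and unit: "norm a = 1" "norm b = 1"
  shows "a = b"
proof (rule ccontr)
  assume "a \<noteq> b"
  obtain u where u: "norm u = 1" "H = {x \<in> sphere 0 1. inner x u > 0}"
    using H by (auto simp: open_hemisphere_def)
  have "H = sphere 0 1 \<inter> {x. inner u x > 0}" using u by (auto simp: inner_commute)
  then have openH: "openin (top_of_set (sphere 0 1)) H"
    by (metis openin_open_Int open_halfspace_gt)
  obtain w where w: "w \<noteq> 0" "inner w u = 0"
    using exists_nonzero_orthogonal[of "{u}"] dim by auto
  have transversal: "inner b t \<le> 0" if t: "inner a t < 0" "\<And>k. u \<noteq> k *\<^sub>R t" for t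
  proof -
    \<comment> \<open>Projecting the pole to the complement of t gives a nonzero z with positive
      product with u; its normalisation is the required point of H.\<close>
    define z where "z = u - (inner u t / inner t t) *\<^sub>R t"
    have "t \<noteq> 0" using t by auto
    then have zt: "inner z t = 0" by (simp add: z_def inner_diff_left)
    have "z \<noteq> 0" using t(2) by (auto simp: z_def)
    have "inner z u = inner z z"
      using zt by (simp add: z_def inner_diff_right)
    then have "inner z u > 0" using \<open>z \<noteq> 0\<close> by simp
    then have "sgn z \<in> H"
      using \<open>z \<noteq> 0\<close> by (simp add: u norm_sgn sgn_div_norm)
    moreover have "inner (sgn z) t = 0" using zt by (simp add: sgn_div_norm)
    ultimately show ?thesis
      using weakly_equivalent_tangent[OF weq openH H(2)] t(1) by blast
  qed
  have less: "inner a b < 1" using unit_vectors_inner_less unit \<open>a \<noteq> b\<close> by blast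
  define t where "t s = b - a + s *\<^sub>R w" for s :: real
  have "isCont (\<lambda>s. inner a (t s)) 0" "isCont (\<lambda>s. inner b (t s)) 0"
    unfolding t_def by (intro continuous_intros)+
  then have lim: "((\<lambda>s. inner a (t s)) \<longlongrightarrow> inner a (b - a)) (at 0)"
    "((\<lambda>s. inner b (t s)) \<longlongrightarrow> inner b (b - a)) (at 0)"
    by (auto simp: isCont_def t_def)
  have "inner a (b - a) < 0" "inner b (b - a) > 0"
    using less unit by (auto simp: inner_diff_right norm_eq_1 inner_commute)
  then have "eventually (\<lambda>s. inner a (t s) < 0) (at 0)" "eventually (\<lambda>s. inner b (t s) > 0) (at 0)"
    using order_tendstoD lim by blast+
  \<comment> \<open>The excluded s is the only one with \<open>t s\<close> orthogonal to w, as every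
    multiple of u is. The filter is punctured at 0, so the excluded value may itself be 0.\<close>
  moreover have "eventually (\<lambda>s. s \<noteq> - inner (b - a) w / inner w w) (at (0::real))"
    by (rule eventually_neq_at_within)
  ultimately have "eventually (\<lambda>s. inner a (t s) < 0 \<and> inner b (t s) > 0
      \<and> s \<noteq> - inner (b - a) w / inner w w) (at (0::real))"
    by eventually_elim auto
  then obtain s where s: "inner a (t s) < 0" "inner b (t s) > 0" "s \<noteq> - inner (b - a) w / inner w w"
    using eventually_happens'[of "at (0::real)"] by auto
  have "inner (t s) w \<noteq> 0"
    using s(3) w by (auto simp: t_def inner_add_left inner_diff_left field_simps)
  then have "u \<noteq> k *\<^sub>R t s" for k
    using w u by (metis inner_commute inner_scaleR_left mult_eq_0_iff norm_zero scale_eq_0_iff zero_neq_one)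
  from transversal[OF s(1) this] s(2) show False by simp
qed

text \<open>The strict premise is an open condition, so it passes to approximating points of Y; the
  non-strict conclusion then survives the limit.\<close>

lemma weakly_equivalent_closure:
  fixes a b :: "'a::real_inner"
  assumes weq: "weakly_equivalent Y a b"
  shows "weakly_equivalent (closure Y) a b"
  unfolding weakly_equivalent_def
proof (intro ballI impI)
  fix p q assume "p \<in> closure Y" "q \<in> closure Y" and less: "inner a p < inner a q"
  then obtain f g where f: "\<And>n. f n \<in> Y" "f \<longlonglongrightarrow> p" and g: "\<And>n. g n \<in> Y" "g \<longlonglongrightarrow> q"
    unfolding closure_sequential by blast
  have "(\<lambda>n. inner a (g n) - inner a (f n)) \<longlonglongrightarrow> inner a q - inner a p"
    by (intro tendsto_intros f g)
  then have "eventually (\<lambda>n. 0 < inner a (g n) - inner a (f n)) sequentially"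
    by (rule order_tendstoD) (use less in simp)
  then have "eventually (\<lambda>n. inner b (f n) \<le> inner b (g n)) sequentially"
    by eventually_elim (use weq f g in \<open>auto simp: weakly_equivalent_def\<close>)
  then show "inner b p \<le> inner b q"
    by (intro tendsto_le[OF _ tendsto_inner[OF tendsto_const g(2)] tendsto_inner[OF tendsto_const f(2)]]) auto
qed

text \<open>Same argument with the functionals varying instead of the points. The hypothesis is
  stated per pair because the sets of the application grow: a fixed pair belongs to them only from
  some index on.\<close>

lemma weakly_equivalent_limit:
  fixes a b :: "'a::real_inner"
  assumes lim: "f \<longlonglongrightarrow> a" "g \<longlonglongrightarrow> b"
    and weq: "\<And>p q. p \<in> Y \<Longrightarrow> q \<in> Y \<Longrightarrow>
      eventually (\<lambda>k. weakly_equivalent {p, q} (f k) (g k)) sequentially"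
  shows "weakly_equivalent Y a b"
  unfolding weakly_equivalent_def
proof (intro ballI impI)
  fix p q assume pq: "p \<in> Y" "q \<in> Y" and less: "inner a p < inner a q"
  have "(\<lambda>n. inner (f n) q - inner (f n) p) \<longlonglongrightarrow> inner a q - inner a p"
    by (intro tendsto_intros lim)
  then have "eventually (\<lambda>n. 0 < inner (f n) q - inner (f n) p) sequentially"
    by (rule order_tendstoD) (use less in simp)
  with weq[OF pq] have "eventually (\<lambda>n. inner (g n) p \<le> inner (g n) q) sequentially"
    by eventually_elim (auto simp: weakly_equivalent_def)
  then show "inner b p \<le> inner b q"
    by (intro tendsto_le[OF _ tendsto_inner[OF lim(2) tendsto_const] tendsto_inner[OF lim(2) tendsto_const]]) auto
qed

theorem theorem2p4:
  fixes y x x' :: "nat \<Rightarrow> real ^ 'p"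
  assumes p_ge_2: "CARD('p) \<ge> 2"
    and y_sphere: "\<And>i. i \<ge> 1 \<Longrightarrow> y i \<in> sphere 0 1"
    and p_eq_2: "CARD('p) = 2 \<Longrightarrow> \<exists>H. open_hemisphere H \<and> H \<subseteq> closure (y ` {1..})"
    and p_ge_3: "CARD('p) \<ge> 3 \<Longrightarrow>
       (top_of_set (sphere 0 1)) interior_of (closure (y ` {1..})) \<noteq> {}"
    and x_sphere: "\<And>n. n \<ge> 1 \<Longrightarrow> x n \<in> sphere 0 1 \<and> x' n \<in> sphere 0 1"
    and weq: "\<And>n. n \<ge> 1 \<Longrightarrow> weakly_equivalent (y ` {1..n}) (x n) (x' n)"
  shows "(\<forall>a. seq_accumulation_point (\<lambda>n. (x n, x' n)) a \<longrightarrow> (\<exists>z \<in> sphere 0 1. a = (z, z)))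
       \<and> (\<forall>l l'. x \<longlonglongrightarrow> l \<and> x' \<longlonglongrightarrow> l' \<longrightarrow> l = l')"
proof -
  have accumulation: "norm a = 1 \<and> a = b"
    if acc: "seq_accumulation_point (\<lambda>n. (x n, x' n)) (a, b)" for a b
  proof -
    obtain r where r: "strict_mono r" "\<And>k. r k \<ge> 1" "(\<lambda>k. (x (r k), x' (r k))) \<longlonglongrightarrow> (a, b)"
      using acc by (auto simp: seq_accumulation_point_def o_def)
    have lim: "(\<lambda>k. x (r k)) \<longlonglongrightarrow> a" "(\<lambda>k. x' (r k)) \<longlonglongrightarrow> b"
      using tendsto_fst[OF r(3)] tendsto_snd[OF r(3)] by simp_all
    have unit: "norm a = 1" "norm b = 1"
      using tendsto_norm[OF lim(1)] tendsto_norm[OF lim(2)] x_sphere r(2)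
      by (auto simp: LIMSEQ_const_iff)
    have "weakly_equivalent (y ` {1..}) a b"
    proof (rule weakly_equivalent_limit[OF lim])
      fix p q assume "p \<in> y ` {1..}" "q \<in> y ` {1..}"
      then obtain i j where ij: "i \<ge> 1" "j \<ge> 1" "p = y i" "q = y j" by auto
      show "eventually (\<lambda>k. weakly_equivalent {p, q} (x (r k)) (x' (r k))) sequentially"
        using eventually_ge_at_top[of "max i j"]
      proof eventually_elim
        case (elim k)
        \<comment> \<open>Strict monotonicity gives r k \<ge> k, hence r k \<ge> max i j.\<close>
        then have "{p, q} \<subseteq> y ` {1..r k}"
          using ij seq_suble[OF r(1), of k] by auto
        with weq[OF r(2)[of k]] show ?case
          unfolding weakly_equivalent_def by blast
      qed
    qed
    then have weq_closure: "weakly_equivalent (closure (y ` {1..})) a b"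
      by (rule weakly_equivalent_closure)
    have "a = b"
    proof (cases "CARD('p) = 2")
      case True
      with p_eq_2 weakly_equivalent_hemisphere_eq[OF _ weq_closure _ _ unit] show ?thesis by auto
    next
      case False
      with p_ge_2 have "CARD('p) \<ge> 3" by simp
      with weakly_equivalent_open_eq[OF _ weq_closure openin_interior_of interior_of_subset _ unit] p_ge_3
      show ?thesis by simp
    qed
    with unit show ?thesis by simp
  qed
  moreover have "l = l'" if "x \<longlonglongrightarrow> l" "x' \<longlonglongrightarrow> l'" for l l'
  proof -
    \<comment> \<open>The shift by one skips index 0, about which nothing is assumed, and makes the
      full sequences an admissible subsequence.\<close>
    have "(\<lambda>n. (x (Suc n), x' (Suc n))) \<longlonglongrightarrow> (l, l')"
      by (intro tendsto_Pair LIMSEQ_Suc that)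
    then have "seq_accumulation_point (\<lambda>n. (x n, x' n)) (l, l')"
      unfolding seq_accumulation_point_def
      by (intro exI[of _ Suc]) (simp add: strict_mono_Suc_iff o_def)
    with accumulation show ?thesis by blast
  qed
  ultimately show ?thesis by force
qed

end
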